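(* Let $X_0 = 0$ and $X_n = \sum_{i=1}^{n} \delta x_i$ for $n \geq 1$ be a random walk starting at the origin, with the only assumption that the increments $\delta x_1, \delta x_2, \dots$ are not correlated and are symmetrically distributed (about $0$). Let $M_k = \max\{X_i : 0 \leq i \leq k\}$ be the maximum of the walk up to time $k$. Then $$\mathbb{E}(M_k) = \sum_{i=1}^{k} \frac{\mathbb{E}(|X_i|)}{2i}.$$
   Context: $\mathbb{E}$ denotes expectation value. The $\delta x_i$ are real random variables, the steps of the walk; $X = \{X_i : i \geq 0\}$ is the walk, and $k \geq 1$ is the number of steps.
   Formalization: "Not correlated" is replaced by independent, and the increments are also assumed identically distributed; as written the claim fails: for δx_1 = 0, δx_2 = ±1 with probability 1/2 each and k = 2, E(M_2) = 1/2 but the sum is 1/4. *)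

theory Defs
  imports "HOL-Probability.Probability"
begin

text \<open>Steps are indexed from 1; the value \<open>dx 0\<close> is never used.\<close>

definition walk :: "(nat \<Rightarrow> 'a \<Rightarrow> real) \<Rightarrow> nat \<Rightarrow> 'a \<Rightarrow> real" where
  "walk dx n \<omega> = (\<Sum>i=1..n. dx i \<omega>)"

definition walk_max :: "(nat \<Rightarrow> 'a \<Rightarrow> real) \<Rightarrow> nat \<Rightarrow> 'a \<Rightarrow> real" where
  "walk_max dx k \<omega> = Max ((\<lambda>i. walk dx i \<omega>) ` {0..k})"

definition symmetric_rv :: "'a measure \<Rightarrow> ('a \<Rightarrow> real) \<Rightarrow> bool" where
  "symmetric_rv M Y \<longleftrightarrow> distr M borel (\<lambda>\<omega>. - Y \<omega>) = distr M borel Y"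

text \<open>
  The steps of a random walk are independent and identically distributed. Neither part can be
  dropped in the maximum formula: it fails for the independent symmetric steps \<open>dx 1 = 0\<close>,
  \<open>dx 2 = 1\<close> or \<open>-1\<close> with probability 1/2 each, and also for suitable identically distributed
  symmetric steps with zero covariance. ``Not correlated'' is therefore read as independence,
  which makes sense without second moments.
\<close>

definition iid_steps :: "'a measure \<Rightarrow> (nat \<Rightarrow> 'a \<Rightarrow> real) \<Rightarrow> bool" where
  "iid_steps M dx \<longleftrightarrow>
     prob_space.indep_vars M (\<lambda>_. borel) dx {1..} \<and>
     (\<forall>i\<ge>1. distr M borel (dx i) = distr M borel (dx 1))"

end

theory Submission
  imports Defs
begin

text \<open>
  Write \<open>S n\<close> for the walk and \<open>M n\<close> for its running maximum. If \<open>S n \<le> 0\<close> then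
  \<open>M n = M (n - 1)\<close>; if \<open>S n > 0\<close> then \<open>M n\<close> is the first step plus the maximum of the walk
  with steps \<open>2, \<dots>, n\<close>. A cyclic shift of the steps fixes \<open>S n\<close> and preserves the joint law,
  so on \<open>S n > 0\<close> the latter maximum has the same expectation as \<open>M (n - 1)\<close>. By
  exchangeability every step contributes equally to the expectation of \<open>S n\<close> on \<open>S n > 0\<close>,
  hence \<open>E (M n) = E (M (n - 1)) + E (max 0 (S n)) / n\<close>, and symmetry of \<open>S n\<close> turns
  \<open>E (max 0 (S n))\<close> into \<open>E \<bar>S n\<bar> / 2\<close>. If the steps are not integrable, both sides
  are infinite because \<open>M k\<close> dominates the positive part of the first step.
\<close>

section \<open>Pathwise identities for the walk and its running maximum\<close>

lemma walk_Suc_shift: "walk dx (Suc n) \<omega> = dx 1 \<omega> + walk (\<lambda>i. dx (Suc i)) n \<omega>"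
  by (induction n) (simp_all add: walk_def)

lemma walk_max_0 [simp]: "walk_max dx 0 \<omega> = 0"
  by (simp add: walk_max_def walk_def)

lemma walk_max_Suc: "walk_max dx (Suc k) \<omega> = max (walk_max dx k \<omega>) (walk dx (Suc k) \<omega>)"
proof -
  have "{0..Suc k} = insert (Suc k) {0..k}" by auto
  then show ?thesis
    unfolding walk_max_def by (simp add: max.commute)
qed

text \<open>Splitting off the first step: the 0 in \<open>max\<close> is the position at time 0, and
  every later position is \<open>dx 1\<close> plus a position of the walk that begins with step
  2.\<close>

lemma walk_max_Suc_shift:
  "walk_max dx (Suc k) \<omega> = max 0 (dx 1 \<omega> + walk_max (\<lambda>i. dx (Suc i)) k \<omega>)"
proof (induction k)
  case 0
  then show ?case by (simp add: walk_max_Suc) (simp add: walk_def)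
next
  case (Suc k)
  then show ?case
    by (simp add: walk_max_Suc[of _ "Suc k"] walk_max_Suc[of "\<lambda>i. dx (Suc i)"] walk_Suc_shift[of dx "Suc k"] max_def)
qed

lemma walk_max_nonneg: "0 \<le> walk_max dx k \<omega>"
  by (induction k) (simp_all add: walk_max_Suc le_max_iff_disj)

lemma walk_max_recurrence:
  "walk_max dx (Suc m) \<omega> = walk_max dx m \<omega> +
     (if walk dx (Suc m) \<omega> > 0
      then dx 1 \<omega> + walk_max (\<lambda>i. dx (Suc i)) m \<omega> - walk_max dx m \<omega> else 0)"
  using walk_max_Suc[of dx m \<omega>] walk_max_Suc_shift[of dx m \<omega>] walk_max_nonneg[of dx m \<omega>]
  by auto

section \<open>Measurability, integrability and congruence\<close>

lemma walk_measurable: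
  assumes "\<And>i. 1 \<le> i \<Longrightarrow> i \<le> n \<Longrightarrow> dx i \<in> borel_measurable M"
  shows "walk dx n \<in> borel_measurable M"
proof -
  have "(\<lambda>\<omega>. \<Sum>i=1..n. dx i \<omega>) \<in> borel_measurable M"
    using assms by (intro borel_measurable_sum) auto
  then show ?thesis by (simp add: walk_def[abs_def])
qed

lemma walk_max_measurable:
  assumes "\<And>i. 1 \<le> i \<Longrightarrow> i \<le> n \<Longrightarrow> dx i \<in> borel_measurable M"
  shows "walk_max dx n \<in> borel_measurable M"
  using assms
proof (induction n)
  case (Suc n)
  then have "(\<lambda>\<omega>. max (walk_max dx n \<omega>) (walk dx (Suc n) \<omega>)) \<in> borel_measurable M"
    using walk_measurable[of "Suc n" dx M] by (intro borel_measurable_max) auto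
  then show ?case by (simp add: walk_max_Suc[abs_def])
qed (simp add: walk_max_0[abs_def])

lemma walk_integrable:
  assumes "\<And>i. 1 \<le> i \<Longrightarrow> i \<le> n \<Longrightarrow> integrable M (dx i)"
  shows "integrable M (walk dx n)"
proof -
  have "integrable M (\<lambda>\<omega>. \<Sum>i=1..n. dx i \<omega>)"
    using assms by (intro Bochner_Integration.integrable_sum) auto
  then show ?thesis by (simp add: walk_def[abs_def])
qed

lemma walk_max_integrable:
  assumes "\<And>i. 1 \<le> i \<Longrightarrow> i \<le> n \<Longrightarrow> integrable M (dx i)"
  shows "integrable M (walk_max dx n)"
  using assms
proof (induction n)
  case (Suc n)
  then have "integrable M (\<lambda>\<omega>. max (walk_max dx n \<omega>) (walk dx (Suc n) \<omega>))"
    using walk_integrable[of "Suc n" M dx] by (intro integrable_max) auto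
  then show ?case by (simp add: walk_max_Suc[abs_def])
qed (simp add: walk_max_0[abs_def])

text \<open>The two sample points may have different types, which allows comparing the walk on
  \<open>M\<close> with the coordinate walk on vectors of steps.\<close>

lemma walk_cong:
  assumes "\<And>i. 1 \<le> i \<Longrightarrow> i \<le> n \<Longrightarrow> dx i \<omega> = dy i \<omega>'"
  shows "walk dx n \<omega> = walk dy n \<omega>'"
  using assms by (simp add: walk_def)

lemma walk_max_cong:
  assumes "\<And>i. 1 \<le> i \<Longrightarrow> i \<le> n \<Longrightarrow> dx i \<omega> = dy i \<omega>'"
  shows "walk_max dx n \<omega> = walk_max dy n \<omega>'"
  unfolding walk_max_def using assms
  by (intro arg_cong[where f = Max] image_cong walk_cong) auto


section \<open>Joint laws of independent families\<close>

text \<open>Independence says that the joint law is the product of the marginals, and the image of a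
  product measure under an injective choice of coordinates is again a product.\<close>

lemma (in prob_space) indep_vars_reindex_inj:
  assumes "indep_vars M' X I" and "inj_on \<sigma> J" and "\<sigma> ` J \<subseteq> I"
  shows "indep_vars (\<lambda>j. M' (\<sigma> j)) (\<lambda>j. X (\<sigma> j)) J"
proof (cases "J = {}")
  case True
  then show ?thesis by (simp add: indep_vars_def indep_sets_def)
next
  case False
  then have "I \<noteq> {}" using assms(3) by auto
  have rv: "random_variable (M' i) (X i)" if "i \<in> I" for i
    using assms(1) that by (auto simp: indep_vars_def)
  have \<sigma>: "\<sigma> \<in> J \<rightarrow> I" using assms(3) by auto
  \<comment> \<open>Nothing is known about \<open>X i\<close> outside \<open>I\<close>; a point mass
    there makes every \<open>D i\<close> a probability measure.\<close>
  define D where "D i = (if i \<in> I then distr M (M' i) (X i) else return (count_space UNIV) undefined)" for i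
  have prob_D: "prob_space (D i)" for i
    unfolding D_def using rv by (auto intro!: prob_space_distr prob_space_return)
  have joint: "distr M (\<Pi>\<^sub>M i\<in>I. M' i) (\<lambda>x. \<lambda>i\<in>I. X i x) = (\<Pi>\<^sub>M i\<in>I. D i)"
    using assms(1) indep_vars_iff_distr_eq_PiM'[OF \<open>I \<noteq> {}\<close> rv]
    by (simp add: D_def cong: PiM_cong)
  have sets_D: "sets (\<Pi>\<^sub>M j\<in>J. D (\<sigma> j)) = sets (\<Pi>\<^sub>M j\<in>J. M' (\<sigma> j))"
    by (intro sets_PiM_cong refl) (use \<sigma> in \<open>auto simp: D_def\<close>)
  have "(\<Pi>\<^sub>M j\<in>J. D (\<sigma> j)) = distr (\<Pi>\<^sub>M i\<in>I. D i) (\<Pi>\<^sub>M j\<in>J. D (\<sigma> j)) (\<lambda>\<omega>. \<lambda>j\<in>J. \<omega> (\<sigma> j))"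
    by (intro distr_PiM_reindex[symmetric] prob_D assms \<sigma>)
  also have "\<dots> = distr (distr M (\<Pi>\<^sub>M i\<in>I. M' i) (\<lambda>x. \<lambda>i\<in>I. X i x)) (\<Pi>\<^sub>M j\<in>J. M' (\<sigma> j)) (\<lambda>\<omega>. \<lambda>j\<in>J. \<omega> (\<sigma> j))"
    unfolding joint by (intro distr_cong refl sets_D)
  also have "\<dots> = distr M (\<Pi>\<^sub>M j\<in>J. M' (\<sigma> j)) (\<lambda>x. \<lambda>j\<in>J. X (\<sigma> j) x)"
  proof (subst distr_distr)
    show "(\<lambda>\<omega>. \<lambda>j\<in>J. \<omega> (\<sigma> j)) \<in> (\<Pi>\<^sub>M i\<in>I. M' i) \<rightarrow>\<^sub>M (\<Pi>\<^sub>M j\<in>J. M' (\<sigma> j))"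
      using \<sigma> by (intro measurable_restrict measurable_component_singleton) auto
    show "(\<lambda>x. \<lambda>i\<in>I. X i x) \<in> M \<rightarrow>\<^sub>M (\<Pi>\<^sub>M i\<in>I. M' i)"
      by (intro measurable_restrict rv)
    show "distr M (\<Pi>\<^sub>M j\<in>J. M' (\<sigma> j)) ((\<lambda>\<omega>. \<lambda>j\<in>J. \<omega> (\<sigma> j)) \<circ> (\<lambda>x. \<lambda>i\<in>I. X i x)) =
      distr M (\<Pi>\<^sub>M j\<in>J. M' (\<sigma> j)) (\<lambda>x. \<lambda>j\<in>J. X (\<sigma> j) x)"
      using \<sigma> by (intro distr_cong refl) (auto simp: restrict_def fun_eq_iff Pi_def)
  qed
  finally have "distr M (\<Pi>\<^sub>M j\<in>J. M' (\<sigma> j)) (\<lambda>x. \<lambda>j\<in>J. X (\<sigma> j) x) = (\<Pi>\<^sub>M j\<in>J. D (\<sigma> j))" ..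
  also have "\<dots> = (\<Pi>\<^sub>M j\<in>J. distr M (M' (\<sigma> j)) (X (\<sigma> j)))"
    using \<sigma> by (intro PiM_cong) (auto simp: D_def)
  finally show ?thesis
    using \<sigma> by (subst indep_vars_iff_distr_eq_PiM'[OF False]) (auto intro: rv)
qed

text \<open>Under independence equal marginals give equal joint laws, and both expectations are
  integrals of \<open>f\<close> against that law.\<close>

lemma (in prob_space) indep_vars_expectation_eq:
  fixes f :: "('i \<Rightarrow> 'b) \<Rightarrow> real"
  assumes "indep_vars N X I" and "indep_vars N Y I"
    and "\<And>i. i \<in> I \<Longrightarrow> distr M (N i) (X i) = distr M (N i) (Y i)"
    and "f \<in> borel_measurable (PiM I N)"
  shows "expectation (\<lambda>\<omega>. f (\<lambda>i\<in>I. X i \<omega>)) = expectation (\<lambda>\<omega>. f (\<lambda>i\<in>I. Y i \<omega>))"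
proof (cases "I = {}")
  case True
  then show ?thesis by (simp add: restrict_def)
next
  case False
  have rv: "random_variable (N i) (X i)" "random_variable (N i) (Y i)" if "i \<in> I" for i
    using assms that by (auto simp: indep_vars_def)
  have joint_X: "distr M (PiM I N) (\<lambda>x. \<lambda>i\<in>I. X i x) = (\<Pi>\<^sub>M i\<in>I. distr M (N i) (X i))"
    using assms(1) indep_vars_iff_distr_eq_PiM'[OF False rv(1)] by simp
  have joint_Y: "distr M (PiM I N) (\<lambda>x. \<lambda>i\<in>I. Y i x) = (\<Pi>\<^sub>M i\<in>I. distr M (N i) (Y i))"
    using assms(2) indep_vars_iff_distr_eq_PiM'[OF False rv(2)] by simp
  have "expectation (\<lambda>\<omega>. f (\<lambda>i\<in>I. X i \<omega>)) = (\<integral>z. f z \<partial>distr M (PiM I N) (\<lambda>x. \<lambda>i\<in>I. X i x))"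
    by (intro integral_distr[symmetric] measurable_restrict rv assms(4))
  also have "\<dots> = (\<integral>z. f z \<partial>distr M (PiM I N) (\<lambda>x. \<lambda>i\<in>I. Y i x))"
    unfolding joint_X joint_Y using assms(3) by (metis (no_types, lifting) PiM_cong)
  also have "\<dots> = expectation (\<lambda>\<omega>. f (\<lambda>i\<in>I. Y i \<omega>))"
    by (intro integral_distr measurable_restrict rv assms(4))
  finally show ?thesis .
qed

section \<open>Walks with integrable i.i.d. steps\<close>

text \<open>Since all steps share one law, integrability of the first passes to the others;
  expectations are then finite and can be added and subtracted.\<close>

locale iid_walk = prob_space M for M :: "'a measure" +
  fixes dx :: "nat \<Rightarrow> 'a \<Rightarrow> real"
  assumes iid: "iid_steps M dx"
    and integrable_first: "integrable M (dx 1)"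
begin

lemma rv_step: "i \<ge> 1 \<Longrightarrow> random_variable borel (dx i)"
  using iid by (auto simp: iid_steps_def indep_vars_def)

lemma distr_step: "i \<ge> 1 \<Longrightarrow> j \<ge> 1 \<Longrightarrow> distr M borel (dx i) = distr M borel (dx j)"
  using iid unfolding iid_steps_def by metis

lemma integrable_step:
  assumes "i \<ge> 1"
  shows "integrable M (dx i)"
proof -
  have "integrable (distr M borel (dx 1)) (\<lambda>x. x)"
    using integrable_first rv_step[of 1] by (simp add: integrable_distr_eq)
  then have "integrable (distr M borel (dx i)) (\<lambda>x. x)"
    using distr_step[OF assms, of 1] by simp
  then show ?thesis
    using rv_step[OF assms] by (simp add: integrable_distr_eq)
qed

lemma indep_steps: "indep_vars (\<lambda>_. borel) dx {1..n}"
  using iid by (auto simp: iid_steps_def intro: indep_vars_subset)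

text \<open>Exchangeability of the steps, applied below to a transposition and to a cyclic
  shift.\<close>

lemma expectation_reindex:
  assumes "inj_on \<sigma> {1..n}" and "\<sigma> ` {1..n} \<subseteq> {1..}"
    and "(f :: (nat \<Rightarrow> real) \<Rightarrow> real) \<in> borel_measurable (\<Pi>\<^sub>M i\<in>{1..n}. borel)"
  shows "expectation (\<lambda>\<omega>. f (\<lambda>i\<in>{1..n}. dx (\<sigma> i) \<omega>)) =
    expectation (\<lambda>\<omega>. f (\<lambda>i\<in>{1..n}. dx i \<omega>))"
proof (rule indep_vars_expectation_eq[OF _ indep_steps _ assms(3)])
  show "indep_vars (\<lambda>_. borel) (\<lambda>i. dx (\<sigma> i)) {1..n}"
    using iid indep_vars_reindex_inj[of "\<lambda>_. borel" dx, OF _ assms(1,2)] by (simp add: iid_steps_def)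
  show "distr M borel (dx (\<sigma> i)) = distr M borel (dx i)" if "i \<in> {1..n}" for i
  proof -
    have "\<sigma> i \<in> {1..}" using assms(2) that by (rule subsetD[OF _ imageI])
    then show ?thesis using that by (intro distr_step) auto
  qed
qed

lemma integrable_on_positive:
  assumes "integrable M (f :: 'a \<Rightarrow> real)"
  shows "integrable M (\<lambda>\<omega>. if walk dx n \<omega> > 0 then f \<omega> else 0)"
proof -
  have [measurable]: "random_variable borel (walk dx n)" "random_variable borel f"
    using walk_measurable[of n dx M] rv_step assms by auto
  show ?thesis
    by (rule Bochner_Integration.integrable_bound[OF assms]) (auto intro!: measurable_If)
qed

text \<open>Swapping steps 1 and \<open>j\<close> preserves the joint law and the endpoint, hence
  the event of a positive endpoint, while the first coordinate becomes \<open>dx j\<close>.\<close>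

lemma expectation_step_on_positive:
  assumes "1 \<le> j" "j \<le> n"
  shows "expectation (\<lambda>\<omega>. if walk dx n \<omega> > 0 then dx j \<omega> else 0) =
    expectation (\<lambda>\<omega>. if walk dx n \<omega> > 0 then dx 1 \<omega> else 0)"
proof -
  define \<sigma> where "\<sigma> = Transposition.transpose 1 j"
  \<comment> \<open>\<open>walk (\<lambda>i x. x i)\<close> is the walk as a function of the vector of its steps.\<close>
  define f :: "(nat \<Rightarrow> real) \<Rightarrow> real" where "f x = (if walk (\<lambda>i x. x i) n x > 0 then x 1 else 0)" for x
  have [measurable]: "walk (\<lambda>i x. x i) n \<in> borel_measurable (\<Pi>\<^sub>M i\<in>{1..n}. borel)"
    by (intro walk_measurable measurable_component_singleton) auto
  have [measurable]: "(\<lambda>x. x 1) \<in> borel_measurable (\<Pi>\<^sub>M i\<in>{1..n}. borel)"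
    using assms by (intro measurable_component_singleton) auto
  have f: "f \<in> borel_measurable (\<Pi>\<^sub>M i\<in>{1..n}. borel)"
    unfolding f_def by measurable
  have bij: "bij_betw \<sigma> {1..n} {1..n}"
    unfolding \<sigma>_def using assms by (intro bij_betw_transpose_iff) auto
  have "walk (\<lambda>i x. x i) n (\<lambda>i\<in>{1..n}. dx (\<sigma> i) \<omega>) = walk dx n \<omega>" for \<omega>
    using sum.reindex_bij_betw[OF bij, of "\<lambda>i. dx i \<omega>"] by (simp add: walk_def)
  then have "f (\<lambda>i\<in>{1..n}. dx (\<sigma> i) \<omega>) = (if walk dx n \<omega> > 0 then dx j \<omega> else 0)" for \<omega>
    using assms by (simp add: f_def \<sigma>_def)
  moreover have "f (\<lambda>i\<in>{1..n}. dx i \<omega>) = (if walk dx n \<omega> > 0 then dx 1 \<omega> else 0)" for \<omega>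
    using assms by (simp add: f_def walk_def)
  ultimately show ?thesis
    using expectation_reindex[OF bij_betw_imp_inj_on[OF bij] _ f] bij by (simp add: bij_betw_def)
qed

text \<open>On a positive endpoint the steps add up to the positive part; otherwise both vanish. The
  \<open>n\<close> summands have equal expectations. The product form also covers
  \<open>n = 0\<close>.\<close>

lemma expectation_first_on_positive:
  "real n * expectation (\<lambda>\<omega>. if walk dx n \<omega> > 0 then dx 1 \<omega> else 0) = expectation (\<lambda>\<omega>. max 0 (walk dx n \<omega>))"
proof -
  have "max 0 (walk dx n \<omega>) = (\<Sum>j=1..n. if walk dx n \<omega> > 0 then dx j \<omega> else 0)" for \<omega>
    by (cases "walk dx n \<omega> > 0") (auto simp: walk_def)
  then have "expectation (\<lambda>\<omega>. max 0 (walk dx n \<omega>)) =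
      (\<Sum>j=1..n. expectation (\<lambda>\<omega>. if walk dx n \<omega> > 0 then dx j \<omega> else 0))"
    by (simp add: integrable_on_positive integrable_step)
  also have "\<dots> = (\<Sum>j=1..n. expectation (\<lambda>\<omega>. if walk dx n \<omega> > 0 then dx 1 \<omega> else 0))"
    by (intro sum.cong refl expectation_step_on_positive) auto
  finally show ?thesis by simp
qed

text \<open>In expectation this cancels the two maxima inside the conditional of
  \<open>walk_max_recurrence\<close>, leaving only the first step.\<close>

lemma expectation_shifted_max_on_positive:
  "expectation (\<lambda>\<omega>. if walk dx (Suc m) \<omega> > 0 then walk_max (\<lambda>i. dx (Suc i)) m \<omega> else 0) =
    expectation (\<lambda>\<omega>. if walk dx (Suc m) \<omega> > 0 then walk_max dx m \<omega> else 0)"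
proof -
  define n where "n = Suc m"
  \<comment> \<open>The cyclic shift of the steps \<open>1, \<dots>, n\<close> leaves the endpoint of the walk unchanged.\<close>
  define \<sigma> where "\<sigma> i = (if i = n then 1 else Suc i)" for i
  define f :: "(nat \<Rightarrow> real) \<Rightarrow> real" where
    "f x = (if walk (\<lambda>i x. x i) n x > 0 then walk_max (\<lambda>i x. x i) m x else 0)" for x
  have [measurable]: "walk (\<lambda>i x. x i) n \<in> borel_measurable (\<Pi>\<^sub>M i\<in>{1..n}. borel)"
    by (intro walk_measurable measurable_component_singleton) auto
  have [measurable]: "walk_max (\<lambda>i x. x i) m \<in> borel_measurable (\<Pi>\<^sub>M i\<in>{1..n}. borel)"
    by (intro walk_max_measurable measurable_component_singleton) (auto simp: n_def)
  have f: "f \<in> borel_measurable (\<Pi>\<^sub>M i\<in>{1..n}. borel)"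
    unfolding f_def by measurable
  \<comment> \<open>Starting at 1 matters: index 0 would also be sent to 1, the image of
    \<open>n\<close>.\<close>
  have inj: "inj_on \<sigma> {1..n}"
    by (auto simp: inj_on_def \<sigma>_def)
  have img: "\<sigma> ` {1..n} \<subseteq> {1..}"
    by (auto simp: \<sigma>_def)
  have "walk (\<lambda>i x. x i) n (\<lambda>i\<in>{1..n}. dx (\<sigma> i) \<omega>) = walk dx n \<omega>" for \<omega>
  proof -
    have "walk (\<lambda>i x. x i) n (\<lambda>i\<in>{1..n}. dx (\<sigma> i) \<omega>) = walk (\<lambda>i. dx (\<sigma> i)) m \<omega> + dx 1 \<omega>"
      by (simp add: walk_def n_def \<sigma>_def)
    also have "walk (\<lambda>i. dx (\<sigma> i)) m \<omega> = walk (\<lambda>i. dx (Suc i)) m \<omega>"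
      by (intro walk_cong) (auto simp: \<sigma>_def n_def)
    finally show ?thesis
      by (simp only: n_def walk_Suc_shift add.commute)
  qed
  moreover have "walk_max (\<lambda>i x. x i) m (\<lambda>i\<in>{1..n}. dx (\<sigma> i) \<omega>) = walk_max (\<lambda>i. dx (Suc i)) m \<omega>" for \<omega>
    by (intro walk_max_cong) (auto simp: \<sigma>_def n_def)
  ultimately have "f (\<lambda>i\<in>{1..n}. dx (\<sigma> i) \<omega>) =
      (if walk dx n \<omega> > 0 then walk_max (\<lambda>i. dx (Suc i)) m \<omega> else 0)" for \<omega>
    by (simp add: f_def)
  moreover have "walk_max (\<lambda>i x. x i) m (\<lambda>i\<in>{1..n}. dx i \<omega>) = walk_max dx m \<omega>" for \<omega>
    by (intro walk_max_cong) (auto simp: n_def)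
  then have "f (\<lambda>i\<in>{1..n}. dx i \<omega>) = (if walk dx n \<omega> > 0 then walk_max dx m \<omega> else 0)" for \<omega>
    by (simp add: f_def walk_def)
  ultimately show ?thesis
    using expectation_reindex[OF inj img f] by (simp add: n_def)
qed

text \<open>The first-moment form of Spitzer's identity, obtained by taking expectations in
  \<open>walk_max_recurrence\<close> at each induction step.\<close>

lemma expectation_walk_max:
  "expectation (walk_max dx k) = (\<Sum>n=1..k. expectation (\<lambda>\<omega>. max 0 (walk dx n \<omega>)) / real n)"
proof (induction k)
  case 0
  then show ?case by (simp add: walk_max_def walk_def)
next
  case (Suc m)
  let ?on = "\<lambda>f \<omega>. if walk dx (Suc m) \<omega> > 0 then f \<omega> else (0::real)"
  let ?shift = "walk_max (\<lambda>i. dx (Suc i)) m"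
  have int: "integrable M (walk_max dx m)" "integrable M (dx 1)" "integrable M ?shift"
    by (auto intro!: walk_max_integrable integrable_step)
  have "walk_max dx (Suc m) \<omega> =
      walk_max dx m \<omega> + (?on (dx 1) \<omega> + ?on ?shift \<omega> - ?on (walk_max dx m) \<omega>)" for \<omega>
    by (simp add: walk_max_recurrence[of dx m])
  then have "expectation (walk_max dx (Suc m)) =
      expectation (\<lambda>\<omega>. walk_max dx m \<omega> + (?on (dx 1) \<omega> + ?on ?shift \<omega> - ?on (walk_max dx m) \<omega>))"
    by (intro Bochner_Integration.integral_cong) auto
  also have "\<dots> = expectation (walk_max dx m) +
      (expectation (?on (dx 1)) + expectation (?on ?shift) - expectation (?on (walk_max dx m)))"
    using int[THEN integrable_on_positive, of "Suc m"] int(1)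
    by simp
  also have "\<dots> = expectation (walk_max dx m) + expectation (?on (dx 1))"
    using expectation_shifted_max_on_positive[of m] by simp
  also have "expectation (?on (dx 1)) = expectation (\<lambda>\<omega>. max 0 (walk dx (Suc m) \<omega>)) / real (Suc m)"
    using expectation_first_on_positive[of "Suc m"] by (simp add: field_simps)
  finally show ?case using Suc.IH by simp
qed

end

section \<open>Consequences of symmetry\<close>

text \<open>\<open>ennreal\<close> sends negative reals to 0, so \<open>ennreal (Y \<omega>)\<close>
  is the positive part; symmetry gives the negative part the same, possibly infinite,
  integral.\<close>

lemma (in prob_space) symmetric_rv_nn_integral_pos:
  assumes "symmetric_rv M Y" and [measurable]: "random_variable borel Y"
  shows "(\<integral>\<^sup>+\<omega>. ennreal \<bar>Y \<omega>\<bar> \<partial>M) = 2 * (\<integral>\<^sup>+\<omega>. ennreal (Y \<omega>) \<partial>M)"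
proof -
  have "(\<integral>\<^sup>+\<omega>. ennreal (- Y \<omega>) \<partial>M) = (\<integral>\<^sup>+y. ennreal y \<partial>distr M borel (\<lambda>\<omega>. - Y \<omega>))"
    by (simp add: nn_integral_distr)
  also have "\<dots> = (\<integral>\<^sup>+\<omega>. ennreal (Y \<omega>) \<partial>M)"
    using assms(1) by (simp add: symmetric_rv_def nn_integral_distr)
  finally have neg: "(\<integral>\<^sup>+\<omega>. ennreal (- Y \<omega>) \<partial>M) = (\<integral>\<^sup>+\<omega>. ennreal (Y \<omega>) \<partial>M)" .
  have "ennreal \<bar>y\<bar> = ennreal y + ennreal (- y)" for y :: real
    by (cases "y \<ge> 0") (auto simp: ennreal_neg)
  then have "(\<integral>\<^sup>+\<omega>. ennreal \<bar>Y \<omega>\<bar> \<partial>M) = (\<integral>\<^sup>+\<omega>. ennreal (Y \<omega>) + ennreal (- Y \<omega>) \<partial>M)"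
    by simp
  also have "\<dots> = (\<integral>\<^sup>+\<omega>. ennreal (Y \<omega>) \<partial>M) + (\<integral>\<^sup>+\<omega>. ennreal (- Y \<omega>) \<partial>M)"
    by (rule nn_integral_add) auto
  finally show ?thesis
    by (simp add: neg mult_2)
qed

lemma (in prob_space) symmetric_rv_expectation_pos:
  assumes "symmetric_rv M Y" and "integrable M Y"
  shows "expectation (\<lambda>\<omega>. max 0 (Y \<omega>)) = expectation (\<lambda>\<omega>. \<bar>Y \<omega>\<bar>) / 2"
proof -
  have [measurable]: "random_variable borel Y" using assms(2) by auto
  have "expectation (\<lambda>\<omega>. max 0 (- Y \<omega>)) = (\<integral>y. max 0 y \<partial>distr M borel (\<lambda>\<omega>. - Y \<omega>))"
    by (simp add: integral_distr)
  also have "\<dots> = expectation (\<lambda>\<omega>. max 0 (Y \<omega>))"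
    using assms(1) by (simp add: symmetric_rv_def integral_distr)
  finally have neg: "expectation (\<lambda>\<omega>. max 0 (- Y \<omega>)) = expectation (\<lambda>\<omega>. max 0 (Y \<omega>))" .
  have "expectation (\<lambda>\<omega>. \<bar>Y \<omega>\<bar>) = expectation (\<lambda>\<omega>. max 0 (Y \<omega>) + max 0 (- Y \<omega>))"
    by (intro Bochner_Integration.integral_cong) auto
  also have "\<dots> = expectation (\<lambda>\<omega>. max 0 (Y \<omega>)) + expectation (\<lambda>\<omega>. max 0 (- Y \<omega>))"
    using assms(2) by (intro Bochner_Integration.integral_add integrable_max) auto
  finally show ?thesis by (simp add: neg)
qed

text \<open>Negating every step preserves each marginal, hence by independence the joint law, and it
  negates the endpoint.\<close>

lemma (in prob_space) symmetric_rv_walk: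
  assumes indep: "indep_vars (\<lambda>_. borel) dx {1..n}"
    and sym: "\<And>i. 1 \<le> i \<Longrightarrow> i \<le> n \<Longrightarrow> symmetric_rv M (dx i)"
  shows "symmetric_rv M (walk dx n)"
\<comment> \<open>The product characterization of independence requires a nonempty index
  set.\<close>
proof (cases "n = 0")
  case True
  then show ?thesis by (simp add: symmetric_rv_def walk_def[abs_def])
next
  case False
  then have ne: "{1..n} \<noteq> {}" by auto
  let ?P = "\<Pi>\<^sub>M i\<in>{1..n}. (borel :: real measure)"
  have rv: "random_variable borel (dx i)" "random_variable borel (\<lambda>\<omega>. - dx i \<omega>)" if "i \<in> {1..n}" for i
    using indep that by (auto simp: indep_vars_def)
  have indep': "indep_vars (\<lambda>_. borel) (\<lambda>i \<omega>. - dx i \<omega>) {1..n}"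
    by (rule indep_vars_compose2[OF indep]) simp
  have W: "walk (\<lambda>i x. x i) n \<in> borel_measurable ?P"
    by (intro walk_measurable measurable_component_singleton) auto
  have "distr M ?P (\<lambda>\<omega>. \<lambda>i\<in>{1..n}. - dx i \<omega>) = (\<Pi>\<^sub>M i\<in>{1..n}. distr M borel (\<lambda>\<omega>. - dx i \<omega>))"
    using indep' indep_vars_iff_distr_eq_PiM'[OF ne rv(2)] by simp
  also have "\<dots> = (\<Pi>\<^sub>M i\<in>{1..n}. distr M borel (dx i))"
    using sym by (intro PiM_cong) (auto simp: symmetric_rv_def)
  also have "\<dots> = distr M ?P (\<lambda>\<omega>. \<lambda>i\<in>{1..n}. dx i \<omega>)"
    using indep indep_vars_iff_distr_eq_PiM'[OF ne rv(1)] by simp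
  finally have joint: "distr M ?P (\<lambda>\<omega>. \<lambda>i\<in>{1..n}. - dx i \<omega>) = distr M ?P (\<lambda>\<omega>. \<lambda>i\<in>{1..n}. dx i \<omega>)" .
  have "distr M borel (\<lambda>\<omega>. - walk dx n \<omega>) =
      distr M borel (walk (\<lambda>i x. x i) n \<circ> (\<lambda>\<omega>. \<lambda>i\<in>{1..n}. - dx i \<omega>))"
    by (intro distr_cong refl) (simp add: walk_def sum_negf)
  also have "\<dots> = distr (distr M ?P (\<lambda>\<omega>. \<lambda>i\<in>{1..n}. - dx i \<omega>)) borel (walk (\<lambda>i x. x i) n)"
    by (intro distr_distr[symmetric] W measurable_restrict rv)
  also have "\<dots> = distr M borel (walk (\<lambda>i x. x i) n \<circ> (\<lambda>\<omega>. \<lambda>i\<in>{1..n}. dx i \<omega>))"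
    unfolding joint by (intro distr_distr W measurable_restrict rv)
  also have "\<dots> = distr M borel (walk dx n)"
    by (intro distr_cong refl) (simp add: walk_def)
  finally show ?thesis by (simp add: symmetric_rv_def)
qed

text \<open>Nonnegative integrals keep the first conjunct meaningful when the values are infinite.
  The second is conditional because \<open>expectation\<close> is 0 by convention on non-integrable
  functions.\<close>

theorem mainTheorem1:
  fixes M :: "'a measure" and dx :: "nat \<Rightarrow> 'a \<Rightarrow> real" and k :: nat
  assumes "prob_space M"
    and "iid_steps M dx"
    and "\<And>i. i \<ge> 1 \<Longrightarrow> symmetric_rv M (dx i)"
    and "k \<ge> 1"
  shows "(\<integral>\<^sup>+\<omega>. ennreal (walk_max dx k \<omega>) \<partial>M) =
           (\<Sum>i=1..k. (\<integral>\<^sup>+\<omega>. ennreal \<bar>walk dx i \<omega>\<bar> \<partial>M) / ennreal (2 * real i)) \<and>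
         (integrable M (dx 1) \<longrightarrow>
           integrable M (walk_max dx k) \<and>
           prob_space.expectation M (walk_max dx k) =
             (\<Sum>i=1..k. prob_space.expectation M (\<lambda>\<omega>. \<bar>walk dx i \<omega>\<bar>) / (2 * real i)))"
proof (cases "integrable M (dx 1)")
  case True
  interpret prob_space M by fact
  interpret iid_walk M dx
    by unfold_locales (use assms True in auto)
  have int: "integrable M (walk dx i)" for i
    by (intro walk_integrable integrable_step)
  have int_max: "integrable M (walk_max dx k)"
    by (intro walk_max_integrable integrable_step)
  have "symmetric_rv M (walk dx i)" for i
    using indep_steps assms(3) by (intro symmetric_rv_walk)
  then have E: "expectation (walk_max dx k) = (\<Sum>i=1..k. expectation (\<lambda>\<omega>. \<bar>walk dx i \<omega>\<bar>) / (2 * real i))"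
    by (simp add: expectation_walk_max symmetric_rv_expectation_pos int)
  \<comment> \<open>All integrals are finite here, so the extended identity is the image of
    \<open>E\<close> under \<open>ennreal\<close>.\<close>
  have "(\<integral>\<^sup>+\<omega>. ennreal (walk_max dx k \<omega>) \<partial>M) = ennreal (expectation (walk_max dx k))"
    by (intro nn_integral_eq_integral int_max) (simp add: walk_max_nonneg)
  also have "\<dots> = (\<Sum>i=1..k. ennreal (expectation (\<lambda>\<omega>. \<bar>walk dx i \<omega>\<bar>) / (2 * real i)))"
    unfolding E by (intro sum_ennreal[symmetric]) auto
  also have "\<dots> = (\<Sum>i=1..k. (\<integral>\<^sup>+\<omega>. ennreal \<bar>walk dx i \<omega>\<bar> \<partial>M) / ennreal (2 * real i))"
  proof (intro sum.cong refl)
    fix i assume "i \<in> {1..k}"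
    then show "ennreal (expectation (\<lambda>\<omega>. \<bar>walk dx i \<omega>\<bar>) / (2 * real i)) =
        (\<integral>\<^sup>+\<omega>. ennreal \<bar>walk dx i \<omega>\<bar> \<partial>M) / ennreal (2 * real i)"
      by (subst nn_integral_eq_integral) (auto intro: int simp: divide_ennreal)
  qed
  finally show ?thesis using int_max E by simp
next
  case False
  interpret prob_space M by fact
  have rv: "random_variable borel (dx 1)"
    using assms(2) by (auto simp: iid_steps_def indep_vars_def)
  have abs_inf: "(\<integral>\<^sup>+\<omega>. ennreal \<bar>dx 1 \<omega>\<bar> \<partial>M) = \<infinity>"
    using False rv by (simp add: integrable_iff_bounded less_top[symmetric])
  \<comment> \<open>A finite positive part would, by symmetry, bound the integral of the absolute
    value.\<close>
  have "(\<integral>\<^sup>+\<omega>. ennreal (dx 1 \<omega>) \<partial>M) = \<infinity>"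
  proof (rule ccontr)
    assume "(\<integral>\<^sup>+\<omega>. ennreal (dx 1 \<omega>) \<partial>M) \<noteq> \<infinity>"
    then have "2 * (\<integral>\<^sup>+\<omega>. ennreal (dx 1 \<omega>) \<partial>M) < \<infinity>"
      by (simp add: ennreal_mult_less_top less_top)
    then show False
      using abs_inf symmetric_rv_nn_integral_pos[OF assms(3) rv] by simp
  qed
  moreover have "dx 1 \<omega> \<le> walk_max dx k \<omega>" for \<omega>
  proof -
    have "walk dx 1 \<omega> \<le> walk_max dx k \<omega>"
      unfolding walk_max_def using assms(4) by (intro Max_ge) auto
    then show ?thesis by (simp add: walk_def)
  qed
  then have "(\<integral>\<^sup>+\<omega>. ennreal (dx 1 \<omega>) \<partial>M) \<le> (\<integral>\<^sup>+\<omega>. ennreal (walk_max dx k \<omega>) \<partial>M)"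
    by (intro nn_integral_mono ennreal_leI)
  ultimately have "(\<integral>\<^sup>+\<omega>. ennreal (walk_max dx k \<omega>) \<partial>M) = \<infinity>"
    by (simp add: top_unique)
  \<comment> \<open>The summand at \<open>i = 1\<close> alone is infinite; it occurs because
    \<open>k \<ge> 1\<close>.\<close>
  moreover have "(\<integral>\<^sup>+\<omega>. ennreal \<bar>walk dx 1 \<omega>\<bar> \<partial>M) / ennreal (2 * real 1) = \<infinity>"
    using abs_inf by (simp add: walk_def ennreal_top_divide)
  then have "(\<Sum>i=1..k. (\<integral>\<^sup>+\<omega>. ennreal \<bar>walk dx i \<omega>\<bar> \<partial>M) / ennreal (2 * real i)) = \<infinity>"
    using assms(4) by (subst sum.remove[of _ 1]) auto
  ultimately show ?thesis using False by (simp only: simp_thms)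
qed

end
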